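(* Let $R$ and $S$ be two semirings. Then $\mathrm{rad}_s(R\times S)=\mathrm{rad}_s(R)\times\mathrm{rad}_s(S)$.
   Context: A semiring $(S,+,\cdot)$ is a set with $(S,+)$ a commutative monoid with identity $0$, $(S,\cdot)$ a semigroup (no multiplicative identity is assumed), multiplication distributing over addition on both sides, and $0s=s0=0$ for all $s$. $R\times S$ is the product semiring with componentwise operations. $\nabla_S=S\times S$. An $S$-semimodule is a right $S$-semimodule: a commutative monoid $(M,+,0_M)$ with a map $M\times S\to M$ such that $(m_1+m_2)s=m_1s+m_2s$, $m(s_1+s_2)=ms_1+ms_2$, $m(s_1s_2)=(ms_1)s_2$, $m0=0_M=0_Ms$. $M$ is called minimal if $MS\neq 0$ (i.e. $ms\ne 0_M$ for some $m\in M,s\in S$) and its only subsemimodules are $(0)$ and $M$; it is called simple if it is minimal and its only $S$-semimodule congruences are the equality relation and $M\times M$. $\mathrm{ann}_S(M)=\{(s_1,s_2)\in S\times S\mid ms_1=ms_2 \text{ for all } m\in M\}$. For any semiring $S$, $\mathrm{rad}_s(S)$ is the intersection of $\mathrm{ann}_S(M)$ over all simple $S$-semimodules $M$, and is $\nabla_S$ if there are none. For relations $\sigma$ on $R$ and $\eta$ on $S$, $\sigma\times\eta=\{((r_1,s_1),(r_2,s_2))\mid (r_1,r_2)\in\sigma \text{ and } (s_1,s_2)\in\eta\}$, a relation on $R\times S$. *)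

theory Defs
  imports "HOL-Algebra.Algebra"
begin

text \<open>
  The semirings here need not have a multiplicative identity, unlike those of the locale
  \<^locale>\<open>semiring\<close>.  They are still presented by ring records, whose field \<^const>\<open>monoid.one\<close> is
  subject to no condition and is never used.
\<close>

locale nonunital_semiring = abelian_monoid S for S (structure) +
  assumes mult_closed: "\<lbrakk>x \<in> carrier S; y \<in> carrier S\<rbrakk> \<Longrightarrow> x \<otimes> y \<in> carrier S"
    and mult_assoc: "\<lbrakk>x \<in> carrier S; y \<in> carrier S; z \<in> carrier S\<rbrakk>
          \<Longrightarrow> (x \<otimes> y) \<otimes> z = x \<otimes> (y \<otimes> z)"
    and distrib_right: "\<lbrakk>x \<in> carrier S; y \<in> carrier S; z \<in> carrier S\<rbrakk>
          \<Longrightarrow> (x \<oplus> y) \<otimes> z = x \<otimes> z \<oplus> y \<otimes> z"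
    and distrib_left: "\<lbrakk>x \<in> carrier S; y \<in> carrier S; z \<in> carrier S\<rbrakk>
          \<Longrightarrow> z \<otimes> (x \<oplus> y) = z \<otimes> x \<oplus> z \<otimes> y"
    and zero_mult: "x \<in> carrier S \<Longrightarrow> \<zero> \<otimes> x = \<zero>"
    and mult_zero: "x \<in> carrier S \<Longrightarrow> x \<otimes> \<zero> = \<zero>"

lemma nonunital_semiring_RDirProd:
  assumes "nonunital_semiring R" and "nonunital_semiring S"
  shows "nonunital_semiring (RDirProd R S)"
proof -
  interpret R: nonunital_semiring R by fact
  interpret S: nonunital_semiring S by fact
  show ?thesis
    by unfold_locales
       (auto simp: RDirProd_def DirProd_def monoid.defs R.a_ac S.a_ac R.mult_closed S.mult_closed
          R.mult_assoc S.mult_assoc R.distrib_right S.distrib_right R.distrib_left S.distrib_left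
          R.zero_mult S.zero_mult R.mult_zero S.mult_zero)
qed

text \<open>
  As in the record of modules over a ring, the multiplicative fields inherited from the ring
  record are unused.
\<close>

record ('s, 'm) right_semimodule = "'m ring" +
  act :: "'m \<Rightarrow> 's \<Rightarrow> 'm"  (infixl \<open>\<star>\<index>\<close> 70)

locale semimodule = S?: nonunital_semiring S + M?: abelian_monoid M
    for S (structure) and M (structure) +
  assumes act_closed: "\<lbrakk>m \<in> carrier M; s \<in> carrier S\<rbrakk> \<Longrightarrow> m \<star>\<^bsub>M\<^esub> s \<in> carrier M"
    and act_add_left: "\<lbrakk>m \<in> carrier M; n \<in> carrier M; s \<in> carrier S\<rbrakk>
          \<Longrightarrow> (m \<oplus>\<^bsub>M\<^esub> n) \<star>\<^bsub>M\<^esub> s = m \<star>\<^bsub>M\<^esub> s \<oplus>\<^bsub>M\<^esub> n \<star>\<^bsub>M\<^esub> s"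
    and act_add_right: "\<lbrakk>m \<in> carrier M; s \<in> carrier S; t \<in> carrier S\<rbrakk>
          \<Longrightarrow> m \<star>\<^bsub>M\<^esub> (s \<oplus>\<^bsub>S\<^esub> t) = m \<star>\<^bsub>M\<^esub> s \<oplus>\<^bsub>M\<^esub> m \<star>\<^bsub>M\<^esub> t"
    and act_mult: "\<lbrakk>m \<in> carrier M; s \<in> carrier S; t \<in> carrier S\<rbrakk>
          \<Longrightarrow> m \<star>\<^bsub>M\<^esub> (s \<otimes>\<^bsub>S\<^esub> t) = (m \<star>\<^bsub>M\<^esub> s) \<star>\<^bsub>M\<^esub> t"
    and act_zero_right: "m \<in> carrier M \<Longrightarrow> m \<star>\<^bsub>M\<^esub> \<zero>\<^bsub>S\<^esub> = \<zero>\<^bsub>M\<^esub>"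
    and act_zero_left: "s \<in> carrier S \<Longrightarrow> \<zero>\<^bsub>M\<^esub> \<star>\<^bsub>M\<^esub> s = \<zero>\<^bsub>M\<^esub>"

definition subsemimodule ::
    "'m set \<Rightarrow> ('s, 'x) ring_scheme \<Rightarrow> ('s, 'm, 'y) right_semimodule_scheme \<Rightarrow> bool" where
  "subsemimodule N S M \<longleftrightarrow>
     N \<subseteq> carrier M \<and> \<zero>\<^bsub>M\<^esub> \<in> N \<and>
     (\<forall>m\<in>N. \<forall>n\<in>N. m \<oplus>\<^bsub>M\<^esub> n \<in> N) \<and>
     (\<forall>m\<in>N. \<forall>s\<in>carrier S. m \<star>\<^bsub>M\<^esub> s \<in> N)"

definition semimodule_congruence ::
    "('m \<times> 'm) set \<Rightarrow> ('s, 'x) ring_scheme \<Rightarrow> ('s, 'm, 'y) right_semimodule_scheme \<Rightarrow> bool" where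
  "semimodule_congruence \<theta> S M \<longleftrightarrow>
     equiv (carrier M) \<theta> \<and>
     (\<forall>(a, b)\<in>\<theta>. \<forall>(c, d)\<in>\<theta>. (a \<oplus>\<^bsub>M\<^esub> c, b \<oplus>\<^bsub>M\<^esub> d) \<in> \<theta>) \<and>
     (\<forall>(a, b)\<in>\<theta>. \<forall>s\<in>carrier S. (a \<star>\<^bsub>M\<^esub> s, b \<star>\<^bsub>M\<^esub> s) \<in> \<theta>)"

definition minimal_semimodule ::
    "('s, 'x) ring_scheme \<Rightarrow> ('s, 'm, 'y) right_semimodule_scheme \<Rightarrow> bool" where
  "minimal_semimodule S M \<longleftrightarrow>
     semimodule S M \<and>
     (\<exists>m\<in>carrier M. \<exists>s\<in>carrier S. m \<star>\<^bsub>M\<^esub> s \<noteq> \<zero>\<^bsub>M\<^esub>) \<and>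
     (\<forall>N. subsemimodule N S M \<longrightarrow> N = {\<zero>\<^bsub>M\<^esub>} \<or> N = carrier M)"

definition simple_semimodule ::
    "('s, 'x) ring_scheme \<Rightarrow> ('s, 'm, 'y) right_semimodule_scheme \<Rightarrow> bool" where
  "simple_semimodule S M \<longleftrightarrow>
     minimal_semimodule S M \<and>
     (\<forall>\<theta>. semimodule_congruence \<theta> S M \<longrightarrow> \<theta> = Id_on (carrier M) \<or> \<theta> = carrier M \<times> carrier M)"

definition ann ::
    "('s, 'x) ring_scheme \<Rightarrow> ('s, 'm, 'y) right_semimodule_scheme \<Rightarrow> ('s \<times> 's) set" where
  "ann S M = {(s, t) \<in> carrier S \<times> carrier S. \<forall>m\<in>carrier M. m \<star>\<^bsub>M\<^esub> s = m \<star>\<^bsub>M\<^esub> t}"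

text \<open>
  A definition in HOL cannot quantify over semimodules whose elements come from arbitrary types.
  It is enough to let the elements come from the type of the elements of \<open>S\<close>: a simple semimodule
  is of the form \<open>m \<star> S\<close>, so it is isomorphic to one carried by a subset of \<open>S\<close>.  That no simple
  semimodule is missed is lemma \<open>rad_s_eq\<close> below: any type of elements into which \<open>S\<close> embeds gives
  the same relation.
\<close>

definition rad_s :: "('s, 'x) ring_scheme \<Rightarrow> ('s \<times> 's) set" where
  "rad_s S =
     (if \<exists>M :: ('s, 's) right_semimodule. simple_semimodule S M
      then \<Inter>{ann S M | M :: ('s, 's) right_semimodule. simple_semimodule S M}
      else carrier S \<times> carrier S)"

definition prod_relation :: "('r \<times> 'r) set \<Rightarrow> ('s \<times> 's) set \<Rightarrow> (('r \<times> 's) \<times> ('r \<times> 's)) set" where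
  "prod_relation \<sigma> \<eta> = {((r1, s1), (r2, s2)) | r1 s1 r2 s2. (r1, r2) \<in> \<sigma> \<and> (s1, s2) \<in> \<eta>}"


subsection \<open>Independence of the radical from the type of elements\<close>

definition image_semimodule ::
    "('m \<Rightarrow> 'n) \<Rightarrow> ('s, 'm, 'y) right_semimodule_scheme \<Rightarrow> ('s, 'n) right_semimodule" where
  "image_semimodule f M =
     (let g = inv_into (carrier M) f in
      \<lparr>carrier = f ` carrier M, monoid.mult = (\<lambda>a b. a), one = f \<zero>\<^bsub>M\<^esub>, ring.zero = f \<zero>\<^bsub>M\<^esub>,
       add = (\<lambda>a b. f (g a \<oplus>\<^bsub>M\<^esub> g b)), act = (\<lambda>a s. f (g a \<star>\<^bsub>M\<^esub> s))\<rparr>)"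

context
  fixes S :: "('s, 'x) ring_scheme" and M :: "('s, 'm, 'y) right_semimodule_scheme"
    and f :: "'m \<Rightarrow> 'n"
  assumes simple: "simple_semimodule S M" and inj: "inj_on f (carrier M)"
begin

interpretation semimodule S M
  using simple by (simp add: simple_semimodule_def minimal_semimodule_def)

private lemma image_simps:
  "carrier (image_semimodule f M) = f ` carrier M"
  "\<zero>\<^bsub>image_semimodule f M\<^esub> = f \<zero>\<^bsub>M\<^esub>"
  "\<lbrakk>m \<in> carrier M; n \<in> carrier M\<rbrakk> \<Longrightarrow> f m \<oplus>\<^bsub>image_semimodule f M\<^esub> f n = f (m \<oplus>\<^bsub>M\<^esub> n)"
  "m \<in> carrier M \<Longrightarrow> f m \<star>\<^bsub>image_semimodule f M\<^esub> s = f (m \<star>\<^bsub>M\<^esub> s)"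
  "\<lbrakk>m \<in> carrier M; n \<in> carrier M\<rbrakk> \<Longrightarrow> f m = f n \<longleftrightarrow> m = n"
  using inj by (auto simp: image_semimodule_def Let_def inj_on_eq_iff)

private lemma image_semimodule_axioms: "semimodule S (image_semimodule f M)"
  by unfold_locales
     (auto simp: image_simps M.a_ac act_closed act_add_left act_add_right act_mult
        act_zero_right act_zero_left)

private lemma image_subsemimodule:
  assumes "subsemimodule N S (image_semimodule f M)"
  shows "N = {f \<zero>\<^bsub>M\<^esub>} \<or> N = f ` carrier M"
proof -
  define N' where "N' = {m \<in> carrier M. f m \<in> N}"
  have N: "N = f ` N'"
    using assms by (auto simp: N'_def subsemimodule_def image_simps)
  have "subsemimodule N' S M"
    unfolding subsemimodule_def
  proof (intro conjI ballI)
    show "N' \<subseteq> carrier M" by (auto simp: N'_def)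
    show "\<zero>\<^bsub>M\<^esub> \<in> N'" using assms by (simp add: N'_def subsemimodule_def image_simps)
  next
    fix m n assume mn: "m \<in> N'" "n \<in> N'"
    then have "f m \<oplus>\<^bsub>image_semimodule f M\<^esub> f n \<in> N"
      using assms by (simp add: N'_def subsemimodule_def)
    then show "m \<oplus>\<^bsub>M\<^esub> n \<in> N'" using mn by (simp add: N'_def image_simps)
  next
    fix m s assume ms: "m \<in> N'" "s \<in> carrier S"
    then have "f m \<star>\<^bsub>image_semimodule f M\<^esub> s \<in> N"
      using assms by (simp add: N'_def subsemimodule_def)
    then show "m \<star>\<^bsub>M\<^esub> s \<in> N'" using ms by (simp add: N'_def image_simps act_closed)
  qed
  then have "N' = {\<zero>\<^bsub>M\<^esub>} \<or> N' = carrier M"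
    using simple by (simp add: simple_semimodule_def minimal_semimodule_def)
  then show ?thesis using N by auto
qed

private lemma image_congruence:
  assumes "semimodule_congruence \<theta> S (image_semimodule f M)"
  shows "\<theta> = Id_on (f ` carrier M) \<or> \<theta> = f ` carrier M \<times> f ` carrier M"
proof -
  define \<theta>' where "\<theta>' = {(m, n) \<in> carrier M \<times> carrier M. (f m, f n) \<in> \<theta>}"
  have eq: "equiv (f ` carrier M) \<theta>"
    using assms by (simp add: semimodule_congruence_def image_simps)
  then have sub: "\<theta> \<subseteq> f ` carrier M \<times> f ` carrier M"
    by (rule equiv_type)
  have \<theta>: "\<theta> = map_prod f f ` \<theta>'"
    using sub by (auto simp: \<theta>'_def image_iff)
  have "equiv (carrier M) \<theta>'"
  proof (rule equivI)
    show "\<theta>' \<subseteq> carrier M \<times> carrier M" by (auto simp: \<theta>'_def)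
    show "refl_on (carrier M) \<theta>'"
      using eq by (auto simp: \<theta>'_def equiv_def refl_on_def)
    show "sym \<theta>'" using eq by (auto simp: \<theta>'_def equiv_def sym_def)
    show "trans \<theta>'"
      using eq unfolding \<theta>'_def equiv_def trans_def by blast
  qed
  moreover have "(a \<oplus>\<^bsub>M\<^esub> c, b \<oplus>\<^bsub>M\<^esub> d) \<in> \<theta>'" if "(a, b) \<in> \<theta>'" "(c, d) \<in> \<theta>'" for a b c d
  proof -
    have "(f a \<oplus>\<^bsub>image_semimodule f M\<^esub> f c, f b \<oplus>\<^bsub>image_semimodule f M\<^esub> f d) \<in> \<theta>"
      using that assms unfolding semimodule_congruence_def \<theta>'_def by blast
    then show ?thesis using that by (simp add: \<theta>'_def image_simps)
  qed
  moreover have "(a \<star>\<^bsub>M\<^esub> s, b \<star>\<^bsub>M\<^esub> s) \<in> \<theta>'" if "(a, b) \<in> \<theta>'" "s \<in> carrier S" for a b s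
  proof -
    have "(f a \<star>\<^bsub>image_semimodule f M\<^esub> s, f b \<star>\<^bsub>image_semimodule f M\<^esub> s) \<in> \<theta>"
      using that assms unfolding semimodule_congruence_def \<theta>'_def by blast
    then show ?thesis using that by (simp add: \<theta>'_def image_simps act_closed)
  qed
  ultimately have "semimodule_congruence \<theta>' S M"
    unfolding semimodule_congruence_def by blast
  then have "\<theta>' = Id_on (carrier M) \<or> \<theta>' = carrier M \<times> carrier M"
    using simple by (simp add: simple_semimodule_def)
  then show ?thesis
  proof
    assume "\<theta>' = Id_on (carrier M)"
    then have "\<theta> = Id_on (f ` carrier M)" using \<theta> by (auto simp: Id_on_def)
    then show ?thesis ..
  next
    assume "\<theta>' = carrier M \<times> carrier M"
    then have "\<theta> = f ` carrier M \<times> f ` carrier M" using \<theta> by auto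
    then show ?thesis ..
  qed
qed

lemma simple_image_semimodule: "simple_semimodule S (image_semimodule f M)"
proof -
  obtain m s where "m \<in> carrier M" "s \<in> carrier S" "m \<star>\<^bsub>M\<^esub> s \<noteq> \<zero>\<^bsub>M\<^esub>"
    using simple by (auto simp: simple_semimodule_def minimal_semimodule_def)
  then have "f m \<in> f ` carrier M" "f m \<star>\<^bsub>image_semimodule f M\<^esub> s \<noteq> f \<zero>\<^bsub>M\<^esub>"
    by (simp_all add: image_simps act_closed)
  then show ?thesis
    using \<open>s \<in> carrier S\<close> image_semimodule_axioms image_subsemimodule image_congruence
    unfolding simple_semimodule_def minimal_semimodule_def image_simps(1,2) by blast
qed

lemma ann_image_semimodule: "ann S (image_semimodule f M) = ann S M"
  by (auto simp: ann_def image_simps act_closed)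

end

lemma simple_semimodule_cyclic:
  assumes "simple_semimodule S M"
  obtains m where "m \<in> carrier M" "carrier M = (\<lambda>s. m \<star>\<^bsub>M\<^esub> s) ` carrier S"
proof -
  interpret semimodule S M
    using assms by (simp add: simple_semimodule_def minimal_semimodule_def)
  obtain m s where m: "m \<in> carrier M" and s: "s \<in> carrier S" "m \<star>\<^bsub>M\<^esub> s \<noteq> \<zero>\<^bsub>M\<^esub>"
    using assms by (auto simp: simple_semimodule_def minimal_semimodule_def)
  let ?N = "(\<lambda>s. m \<star>\<^bsub>M\<^esub> s) ` carrier S"
  have "subsemimodule ?N S M"
    unfolding subsemimodule_def
  proof (intro conjI ballI)
    show "?N \<subseteq> carrier M" using m by (auto simp: act_closed)
    show "\<zero>\<^bsub>M\<^esub> \<in> ?N" using act_zero_right[OF m] S.zero_closed by (metis imageI)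
  next
    fix a b assume "a \<in> ?N" "b \<in> ?N"
    then show "a \<oplus>\<^bsub>M\<^esub> b \<in> ?N"
      using m by (auto simp: act_add_right[symmetric])
  next
    fix a t assume "a \<in> ?N" "t \<in> carrier S"
    then show "a \<star>\<^bsub>M\<^esub> t \<in> ?N"
      using m by (auto simp: act_mult[symmetric] S.mult_closed)
  qed
  then have "?N = {\<zero>\<^bsub>M\<^esub>} \<or> ?N = carrier M"
    using assms by (simp add: simple_semimodule_def minimal_semimodule_def)
  then have "carrier M = ?N" using s by blast
  then show ?thesis using m that by blast
qed

lemma simple_semimodule_transfer:
  fixes S :: "('s, 'x) ring_scheme" and M :: "('s, 'm, 'y) right_semimodule_scheme"
    and e :: "'s \<Rightarrow> 'n"
  assumes M: "simple_semimodule S M" and e: "inj_on e (carrier S)"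
  obtains M' :: "('s, 'n) right_semimodule"
  where "simple_semimodule S M'" "ann S M' = ann S M"
proof -
  obtain m where m: "carrier M = (\<lambda>s. m \<star>\<^bsub>M\<^esub> s) ` carrier S"
    using simple_semimodule_cyclic[OF M] .
  define h where "h = inv_into (carrier S) (\<lambda>s. m \<star>\<^bsub>M\<^esub> s)"
  have "inj_on h (carrier M)" "h ` carrier M \<subseteq> carrier S"
    by (auto simp: h_def m inj_on_inv_into intro: inv_into_into)
  then have "inj_on (e \<circ> h) (carrier M)"
    using e by (intro comp_inj_on) (auto intro: inj_on_subset)
  then show ?thesis
    using that[OF simple_image_semimodule[OF M] ann_image_semimodule[OF M]] by blast
qed

lemma rad_s_subset_ann:
  fixes M :: "('s, 'm, 'y) right_semimodule_scheme"
  assumes "simple_semimodule S M"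
  shows "rad_s S \<subseteq> ann S M"
proof -
  obtain M' :: "('s, 's) right_semimodule" where "simple_semimodule S M'" "ann S M' = ann S M"
    using simple_semimodule_transfer[OF assms, of id] by auto
  then show ?thesis unfolding rad_s_def by auto
qed

lemma rad_s_eq:
  fixes S :: "('s, 'x) ring_scheme" and e :: "'s \<Rightarrow> 'm"
  assumes "inj_on e (carrier S)"
  shows "rad_s S =
     (if \<exists>M :: ('s, 'm) right_semimodule. simple_semimodule S M
      then \<Inter>{ann S M | M :: ('s, 'm) right_semimodule. simple_semimodule S M}
      else carrier S \<times> carrier S)"
proof -
  have "{ann S M | M :: ('s, 's) right_semimodule. simple_semimodule S M} =
        {ann S M | M :: ('s, 'm) right_semimodule. simple_semimodule S M}" (is "?A = ?B")
  proof
    show "?A \<subseteq> ?B" using simple_semimodule_transfer[OF _ assms] by (smt (verit) mem_Collect_eq subsetI)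
    show "?B \<subseteq> ?A" using simple_semimodule_transfer[of S _ id] inj_on_id2
      by (smt (verit) mem_Collect_eq subsetI inj_on_id)
  qed
  moreover from this have "(\<exists>M :: ('s, 's) right_semimodule. simple_semimodule S M) \<longleftrightarrow>
        (\<exists>M :: ('s, 'm) right_semimodule. simple_semimodule S M)" by blast
  ultimately show ?thesis by (simp add: rad_s_def)
qed

end

theory Submission
  imports Defs
begin

text \<open>
  The simple semimodules over \<open>R \<times> S\<close> are exactly those over \<open>R\<close> and those over \<open>S\<close>, with the other
  factor acting as zero.

  One direction is restriction of scalars along the two projections.  For the other, let \<open>M\<close> be
  simple over \<open>R \<times> S\<close>.  The elements of \<open>M\<close> that are killed by \<open>0 \<times> S\<close> form a subsemimodule, so
  they are \<open>0\<close> or \<open>M\<close>.  Since \<open>(R \<times> 0)(0 \<times> S) = 0\<close>, they include every \<open>m (r, 0)\<close>; hence one of the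
  two factors kills \<open>M\<close> (lemma \<open>simple_RDirProd_factor_trivial\<close>).
  Then \<open>M\<close> has the same structure over the other factor, by restriction along its inclusion.

  All four passages are instances of one principle (\<open>simple_restrict_scalars\<close>): restriction of
  scalars along \<open>f : A \<rightarrow> B\<close> preserves simplicity as soon as \<open>f\<close> is onto up to the action on \<open>M\<close>,
  because then the subsemimodules and the congruences stay the same.  The annihilator of the
  restriction is the preimage of the annihilator under \<open>f\<close>, so intersecting over all simple
  semimodules gives the product of the two radicals.
\<close>

section \<open>Restriction of scalars\<close>

definition nonunital_hom ::
    "('a \<Rightarrow> 'b) \<Rightarrow> ('a, 'x) ring_scheme \<Rightarrow> ('b, 'y) ring_scheme \<Rightarrow> bool" where
  "nonunital_hom f A B \<longleftrightarrow>
     f \<in> carrier A \<rightarrow> carrier B \<and> f \<zero>\<^bsub>A\<^esub> = \<zero>\<^bsub>B\<^esub> \<and>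
     (\<forall>a\<in>carrier A. \<forall>b\<in>carrier A. f (a \<oplus>\<^bsub>A\<^esub> b) = f a \<oplus>\<^bsub>B\<^esub> f b \<and> f (a \<otimes>\<^bsub>A\<^esub> b) = f a \<otimes>\<^bsub>B\<^esub> f b)"

definition restrict_scalars ::
    "('a \<Rightarrow> 'b) \<Rightarrow> ('b, 'm, 'y) right_semimodule_scheme \<Rightarrow> ('a, 'm) right_semimodule" where
  "restrict_scalars f M =
     \<lparr>carrier = carrier M, monoid.mult = monoid.mult M, one = \<one>\<^bsub>M\<^esub>, ring.zero = \<zero>\<^bsub>M\<^esub>,
      add = add M, act = (\<lambda>m a. m \<star>\<^bsub>M\<^esub> f a)\<rparr>"

lemma restrict_scalars_simps [simp]:
  "carrier (restrict_scalars f M) = carrier M"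
  "\<zero>\<^bsub>restrict_scalars f M\<^esub> = \<zero>\<^bsub>M\<^esub>"
  "m \<oplus>\<^bsub>restrict_scalars f M\<^esub> n = m \<oplus>\<^bsub>M\<^esub> n"
  "m \<star>\<^bsub>restrict_scalars f M\<^esub> a = m \<star>\<^bsub>M\<^esub> f a"
  by (simp_all add: restrict_scalars_def)

lemma semimodule_restrict_scalars:
  assumes A: "nonunital_semiring A" and f: "nonunital_hom f A B" and M: "semimodule B M"
  shows "semimodule A (restrict_scalars f M)"
proof -
  interpret A: nonunital_semiring A by fact
  interpret semimodule B M by fact
  have f_simps: "a \<in> carrier A \<Longrightarrow> f a \<in> carrier B" "f \<zero>\<^bsub>A\<^esub> = \<zero>\<^bsub>B\<^esub>"
    "\<lbrakk>a \<in> carrier A; b \<in> carrier A\<rbrakk> \<Longrightarrow> f (a \<oplus>\<^bsub>A\<^esub> b) = f a \<oplus>\<^bsub>B\<^esub> f b"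
    "\<lbrakk>a \<in> carrier A; b \<in> carrier A\<rbrakk> \<Longrightarrow> f (a \<otimes>\<^bsub>A\<^esub> b) = f a \<otimes>\<^bsub>B\<^esub> f b" for a b
    using f by (auto simp: nonunital_hom_def)
  show ?thesis
    by unfold_locales
       (auto simp: f_simps M.a_ac act_closed act_add_left act_add_right act_mult
          act_zero_right act_zero_left)
qed

text \<open>
  Every scalar of \<open>B\<close> acts on \<open>M\<close> like the image of some scalar of \<open>A\<close>, so closure under the
  action of \<open>A\<close> is closure under the action of \<open>B\<close>, for subsets of \<open>M\<close> and for relations on \<open>M\<close>.
\<close>

lemma simple_restrict_scalars:
  assumes A: "nonunital_semiring A" and f: "nonunital_hom f A B" and M: "simple_semimodule B M"
    and onto: "\<And>b. b \<in> carrier B \<Longrightarrow> \<exists>a\<in>carrier A. \<forall>m\<in>carrier M. m \<star>\<^bsub>M\<^esub> f a = m \<star>\<^bsub>M\<^esub> b"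
  shows "simple_semimodule A (restrict_scalars f M)"
proof -
  have M': "semimodule B M"
    using M by (simp add: simple_semimodule_def minimal_semimodule_def)
  have sub: "subsemimodule N B M" if N: "subsemimodule N A (restrict_scalars f M)" for N
  proof -
    have "m \<star>\<^bsub>M\<^esub> b \<in> N" if "m \<in> N" "b \<in> carrier B" for m b
    proof -
      obtain a where "a \<in> carrier A" "\<forall>m\<in>carrier M. m \<star>\<^bsub>M\<^esub> f a = m \<star>\<^bsub>M\<^esub> b"
        using onto \<open>b \<in> carrier B\<close> by blast
      moreover have "m \<in> carrier M" using N \<open>m \<in> N\<close> by (auto simp: subsemimodule_def)
      moreover have "m \<star>\<^bsub>M\<^esub> f a \<in> N"
        using N \<open>m \<in> N\<close> \<open>a \<in> carrier A\<close> by (auto simp: subsemimodule_def)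
      ultimately show ?thesis by simp
    qed
    then show ?thesis using N by (simp add: subsemimodule_def)
  qed
  have cong: "semimodule_congruence \<theta> B M"
    if \<theta>: "semimodule_congruence \<theta> A (restrict_scalars f M)" for \<theta>
  proof -
    have "(m \<star>\<^bsub>M\<^esub> b, n \<star>\<^bsub>M\<^esub> b) \<in> \<theta>" if "(m, n) \<in> \<theta>" "b \<in> carrier B" for m n b
    proof -
      obtain a where a: "a \<in> carrier A" "\<forall>m\<in>carrier M. m \<star>\<^bsub>M\<^esub> f a = m \<star>\<^bsub>M\<^esub> b"
        using onto \<open>b \<in> carrier B\<close> by blast
      have "\<theta> \<subseteq> carrier M \<times> carrier M"
        using \<theta> by (simp add: semimodule_congruence_def equiv_type)
      then have "m \<in> carrier M" "n \<in> carrier M" using \<open>(m, n) \<in> \<theta>\<close> by auto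
      moreover have "(m \<star>\<^bsub>M\<^esub> f a, n \<star>\<^bsub>M\<^esub> f a) \<in> \<theta>"
        using \<theta> \<open>(m, n) \<in> \<theta>\<close> a(1) by (auto simp: semimodule_congruence_def)
      ultimately show ?thesis using a(2) by simp
    qed
    then show ?thesis using \<theta> by (auto simp: semimodule_congruence_def)
  qed
  obtain m b where "m \<in> carrier M" "b \<in> carrier B" "m \<star>\<^bsub>M\<^esub> b \<noteq> \<zero>\<^bsub>M\<^esub>"
    using M by (auto simp: simple_semimodule_def minimal_semimodule_def)
  then have "\<exists>m\<in>carrier M. \<exists>a\<in>carrier A. m \<star>\<^bsub>M\<^esub> f a \<noteq> \<zero>\<^bsub>M\<^esub>"
    using onto by metis
  then show ?thesis
    using M sub cong semimodule_restrict_scalars[OF A f M']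
    by (simp add: simple_semimodule_def minimal_semimodule_def)
qed

lemma ann_restrict_scalars:
  assumes "nonunital_hom f A B"
  shows "ann A (restrict_scalars f M) =
    {(a, b) \<in> carrier A \<times> carrier A. (f a, f b) \<in> ann B M}"
  using assms by (auto simp: ann_def nonunital_hom_def)

text \<open>
  The convention for semirings without simple semimodules is the intersection of the empty family
  within \<open>S \<times> S\<close>, so membership needs no case distinction.
\<close>

lemma rad_s_iff:
  "(s, t) \<in> rad_s S \<longleftrightarrow> s \<in> carrier S \<and> t \<in> carrier S \<and>
     (\<forall>M :: ('s, 's) right_semimodule. simple_semimodule S M \<longrightarrow> (s, t) \<in> ann S M)"
  for S :: "('s, 'x) ring_scheme"
  by (auto simp: rad_s_def ann_def)

text \<open>
  Along a surjection the simple \<open>B\<close>-semimodules become some of the simple \<open>A\<close>-semimodules.  There may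
  be others over \<open>A\<close>, so the converse fails in general.
\<close>

lemma rad_s_surjection:
  fixes A :: "('a, 'x) ring_scheme" and B :: "('b, 'y) ring_scheme"
  assumes A: "nonunital_semiring A" and f: "nonunital_hom f A B"
    and surj: "f ` carrier A = carrier B" and st: "(s, t) \<in> rad_s A"
  shows "(f s, f t) \<in> rad_s B"
  unfolding rad_s_iff
proof (intro conjI allI impI)
  show "f s \<in> carrier B" "f t \<in> carrier B"
    using st surj by (auto simp: rad_s_iff)
  fix M :: "('b, 'b) right_semimodule" assume M: "simple_semimodule B M"
  have "\<exists>a\<in>carrier A. \<forall>m\<in>carrier M. m \<star>\<^bsub>M\<^esub> f a = m \<star>\<^bsub>M\<^esub> b" if "b \<in> carrier B" for b
    using that unfolding surj[symmetric] by auto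
  then have "simple_semimodule A (restrict_scalars f M)"
    by (rule simple_restrict_scalars[OF A f M])
  then have "(s, t) \<in> ann A (restrict_scalars f M)"
    using rad_s_subset_ann st by blast
  then show "(f s, f t) \<in> ann B M"
    by (simp add: ann_restrict_scalars[OF f])
qed

section \<open>Simple semimodules over a direct product\<close>

lemma RDirProd_simps:
  "carrier (RDirProd R S) = carrier R \<times> carrier S"
  "\<zero>\<^bsub>RDirProd R S\<^esub> = (\<zero>\<^bsub>R\<^esub>, \<zero>\<^bsub>S\<^esub>)"
  "(a, b) \<oplus>\<^bsub>RDirProd R S\<^esub> (c, d) = (a \<oplus>\<^bsub>R\<^esub> c, b \<oplus>\<^bsub>S\<^esub> d)"
  "(a, b) \<otimes>\<^bsub>RDirProd R S\<^esub> (c, d) = (a \<otimes>\<^bsub>R\<^esub> c, b \<otimes>\<^bsub>S\<^esub> d)"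
  by (simp_all add: RDirProd_def DirProd_def monoid.defs)

text \<open>
  Every \<open>m (r, 0)\<close> is killed by \<open>0 \<times> S\<close>; if one of them is nonzero, then the subsemimodule of all
  elements killed by \<open>0 \<times> S\<close> is \<open>M\<close>.
\<close>

lemma simple_RDirProd_factor_trivial:
  assumes R: "nonunital_semiring R" and S: "nonunital_semiring S"
    and M: "simple_semimodule (RDirProd R S) M"
  shows "(\<forall>m\<in>carrier M. \<forall>r\<in>carrier R. m \<star>\<^bsub>M\<^esub> (r, \<zero>\<^bsub>S\<^esub>) = \<zero>\<^bsub>M\<^esub>) \<or>
         (\<forall>m\<in>carrier M. \<forall>s\<in>carrier S. m \<star>\<^bsub>M\<^esub> (\<zero>\<^bsub>R\<^esub>, s) = \<zero>\<^bsub>M\<^esub>)"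
proof -
  interpret R: nonunital_semiring R by fact
  interpret S: nonunital_semiring S by fact
  interpret P: semimodule "RDirProd R S" M
    using M by (simp add: simple_semimodule_def minimal_semimodule_def)
  define N where "N = {m \<in> carrier M. \<forall>s\<in>carrier S. m \<star>\<^bsub>M\<^esub> (\<zero>\<^bsub>R\<^esub>, s) = \<zero>\<^bsub>M\<^esub>}"
  have mult: "(m \<star>\<^bsub>M\<^esub> (r, s)) \<star>\<^bsub>M\<^esub> (r', s') = m \<star>\<^bsub>M\<^esub> (r \<otimes>\<^bsub>R\<^esub> r', s \<otimes>\<^bsub>S\<^esub> s')"
    if "m \<in> carrier M" "r \<in> carrier R" "s \<in> carrier S" "r' \<in> carrier R" "s' \<in> carrier S"
    for m r s r' s'
    using P.act_mult[of m "(r, s)" "(r', s')"] that by (simp add: RDirProd_simps)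
  have "subsemimodule N (RDirProd R S) M"
    unfolding subsemimodule_def N_def
    by (auto simp: RDirProd_simps P.act_zero_left P.act_add_left P.act_closed mult
        R.mult_zero S.mult_closed)
  then have N: "N = {\<zero>\<^bsub>M\<^esub>} \<or> N = carrier M"
    using M by (simp add: simple_semimodule_def minimal_semimodule_def)
  have "m \<star>\<^bsub>M\<^esub> (r, \<zero>\<^bsub>S\<^esub>) \<in> N" if "m \<in> carrier M" "r \<in> carrier R" for m r
    using that P.act_zero_right[of m]
    by (simp add: N_def P.act_closed RDirProd_simps mult R.mult_zero S.zero_mult)
  then show ?thesis using N unfolding N_def by blast
qed

lemma nonunital_hom_projections:
  "nonunital_hom fst (RDirProd R S) R" "nonunital_hom snd (RDirProd R S) S"
  by (auto simp: nonunital_hom_def RDirProd_simps)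

lemma nonunital_hom_inclusions:
  assumes "nonunital_semiring R" and "nonunital_semiring S"
  shows "nonunital_hom (\<lambda>r. (r, \<zero>\<^bsub>S\<^esub>)) R (RDirProd R S)"
    and "nonunital_hom (\<lambda>s. (\<zero>\<^bsub>R\<^esub>, s)) S (RDirProd R S)"
proof -
  interpret R: nonunital_semiring R by fact
  interpret S: nonunital_semiring S by fact
  show "nonunital_hom (\<lambda>r. (r, \<zero>\<^bsub>S\<^esub>)) R (RDirProd R S)"
    "nonunital_hom (\<lambda>s. (\<zero>\<^bsub>R\<^esub>, s)) S (RDirProd R S)"
    by (auto simp: nonunital_hom_def RDirProd_simps R.mult_zero S.mult_zero)
qed

text \<open>
  If, say, \<open>R \<times> 0\<close> kills \<open>M\<close>, then \<open>(r, s) = (r, 0) + (0, s)\<close> acts like \<open>(0, s)\<close>.  This makes the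
  inclusion of \<open>S\<close> onto up to the action, so the restriction to \<open>S\<close> is simple; it also makes the
  annihilator of \<open>M\<close> depend on the second components alone.
\<close>

lemma prod_rad_s_in_ann:
  assumes R: "nonunital_semiring R" and S: "nonunital_semiring S"
    and M: "simple_semimodule (RDirProd R S) M"
    and r: "(r1, r2) \<in> rad_s R" and s: "(s1, s2) \<in> rad_s S"
  shows "((r1, s1), (r2, s2)) \<in> ann (RDirProd R S) M"
proof -
  interpret R: nonunital_semiring R by fact
  interpret S: nonunital_semiring S by fact
  interpret P: semimodule "RDirProd R S" M
    using M by (simp add: simple_semimodule_def minimal_semimodule_def)
  note incl = nonunital_hom_inclusions[OF R S]
  have split: "m \<star>\<^bsub>M\<^esub> (a, b) = m \<star>\<^bsub>M\<^esub> (a, \<zero>\<^bsub>S\<^esub>) \<oplus>\<^bsub>M\<^esub> m \<star>\<^bsub>M\<^esub> (\<zero>\<^bsub>R\<^esub>, b)"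
    if "m \<in> carrier M" "a \<in> carrier R" "b \<in> carrier S" for m a b
    using P.act_add_right[of m "(a, \<zero>\<^bsub>S\<^esub>)" "(\<zero>\<^bsub>R\<^esub>, b)"] that by (simp add: RDirProd_simps)
  have carr: "r1 \<in> carrier R" "r2 \<in> carrier R" "s1 \<in> carrier S" "s2 \<in> carrier S"
    using r s by (auto simp: rad_s_iff)
  consider "\<forall>m\<in>carrier M. \<forall>r\<in>carrier R. m \<star>\<^bsub>M\<^esub> (r, \<zero>\<^bsub>S\<^esub>) = \<zero>\<^bsub>M\<^esub>"
    | "\<forall>m\<in>carrier M. \<forall>s\<in>carrier S. m \<star>\<^bsub>M\<^esub> (\<zero>\<^bsub>R\<^esub>, s) = \<zero>\<^bsub>M\<^esub>"
    using simple_RDirProd_factor_trivial[OF R S M] by blast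
  then show ?thesis
  proof cases
    case 1
    then have act: "m \<star>\<^bsub>M\<^esub> (a, b) = m \<star>\<^bsub>M\<^esub> (\<zero>\<^bsub>R\<^esub>, b)"
      if "m \<in> carrier M" "a \<in> carrier R" "b \<in> carrier S" for m a b
      using split[OF that] that by (simp add: P.act_closed RDirProd_simps)
    have "\<exists>c\<in>carrier S. \<forall>m\<in>carrier M. m \<star>\<^bsub>M\<^esub> (\<zero>\<^bsub>R\<^esub>, c) = m \<star>\<^bsub>M\<^esub> p"
      if p: "p \<in> carrier (RDirProd R S)" for p
    proof -
      obtain a b where "p = (a, b)" "a \<in> carrier R" "b \<in> carrier S"
        using p by (auto simp: RDirProd_simps)
      then show ?thesis using act[of _ a b] by (intro bexI[of _ b]) simp_all
    qed
    then have "simple_semimodule S (restrict_scalars (\<lambda>s. (\<zero>\<^bsub>R\<^esub>, s)) M)"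
      by (rule simple_restrict_scalars[OF S incl(2) M])
    then have "(s1, s2) \<in> ann S (restrict_scalars (\<lambda>s. (\<zero>\<^bsub>R\<^esub>, s)) M)"
      using rad_s_subset_ann s by blast
    then show ?thesis
      using carr act[of _ r1 s1] act[of _ r2 s2] by (simp add: ann_def RDirProd_simps)
  next
    case 2
    then have act: "m \<star>\<^bsub>M\<^esub> (a, b) = m \<star>\<^bsub>M\<^esub> (a, \<zero>\<^bsub>S\<^esub>)"
      if "m \<in> carrier M" "a \<in> carrier R" "b \<in> carrier S" for m a b
      using split[OF that] that by (simp add: P.act_closed RDirProd_simps)
    have "\<exists>c\<in>carrier R. \<forall>m\<in>carrier M. m \<star>\<^bsub>M\<^esub> (c, \<zero>\<^bsub>S\<^esub>) = m \<star>\<^bsub>M\<^esub> p"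
      if p: "p \<in> carrier (RDirProd R S)" for p
    proof -
      obtain a b where "p = (a, b)" "a \<in> carrier R" "b \<in> carrier S"
        using p by (auto simp: RDirProd_simps)
      then show ?thesis using act[of _ a b] by (intro bexI[of _ a]) simp_all
    qed
    then have "simple_semimodule R (restrict_scalars (\<lambda>r. (r, \<zero>\<^bsub>S\<^esub>)) M)"
      by (rule simple_restrict_scalars[OF R incl(1) M])
    then have "(r1, r2) \<in> ann R (restrict_scalars (\<lambda>r. (r, \<zero>\<^bsub>S\<^esub>)) M)"
      using rad_s_subset_ann r by blast
    then show ?thesis
      using carr act[of _ r1 s1] act[of _ r2 s2] by (simp add: ann_def RDirProd_simps)
  qed
qed

theorem theorem3p14:
  fixes R :: "('r, 'x) ring_scheme" and S :: "('s, 'y) ring_scheme"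
  assumes "nonunital_semiring R" and "nonunital_semiring S"
  shows "rad_s (RDirProd R S) = prod_relation (rad_s R) (rad_s S)"
proof -
  interpret R: nonunital_semiring R by fact
  interpret S: nonunital_semiring S by fact
  note P = nonunital_semiring_RDirProd[OF assms]
  have surj: "fst ` carrier (RDirProd R S) = carrier R" "snd ` carrier (RDirProd R S) = carrier S"
    by (force simp: RDirProd_simps)+
  have "((r1, s1), (r2, s2)) \<in> rad_s (RDirProd R S) \<longleftrightarrow>
      (r1, r2) \<in> rad_s R \<and> (s1, s2) \<in> rad_s S" for r1 r2 s1 s2
  proof
    assume rad: "((r1, s1), (r2, s2)) \<in> rad_s (RDirProd R S)"
    show "(r1, r2) \<in> rad_s R \<and> (s1, s2) \<in> rad_s S"
      using rad_s_surjection[OF P nonunital_hom_projections(1) surj(1) rad]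
        rad_s_surjection[OF P nonunital_hom_projections(2) surj(2) rad] by simp
  next
    assume rad: "(r1, r2) \<in> rad_s R \<and> (s1, s2) \<in> rad_s S"
    then have "(r1, s1) \<in> carrier (RDirProd R S)" "(r2, s2) \<in> carrier (RDirProd R S)"
      by (auto simp: rad_s_iff RDirProd_simps)
    moreover have "((r1, s1), (r2, s2)) \<in> ann (RDirProd R S) M"
      if "simple_semimodule (RDirProd R S) M"
      for M :: "('r \<times> 's, 'r \<times> 's) right_semimodule"
      using prod_rad_s_in_ann[OF assms that] rad by simp
    ultimately show "((r1, s1), (r2, s2)) \<in> rad_s (RDirProd R S)"
      unfolding rad_s_iff[of "(r1, s1)"] by simp
  qed
  then show ?thesis by (auto simp: prod_relation_def)
qed

end
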